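(* For every $n\ge 1$, every $\alpha\in[0,1]$ and every $\theta\in\Omega$, the symmetric matrix $g_\alpha(\theta)$ is positive-definite.
   Context: For $n\ge1$ and $\theta=(\theta^1,\dots,\theta^n)\in\mathbb R^n$ write $u_i:=e^{\theta^i}$, and let $\Omega:=\{\theta\in\mathbb R^n:\sum_i u_i<1\}$. On $\Omega$ define $\Psi_+(\theta):=\log(1+\sum_i u_i)$ and $\Psi_-(\theta):=-\log(1-\sum_i u_i)$. For $\alpha\in[0,1]$ set $\Psi_\alpha:=\alpha\Psi_++(1-\alpha)\Psi_-$ and let $g_\alpha(\theta):=\operatorname{Hess}_\theta\Psi_\alpha(\theta)=\alpha\,h_+(\theta)+(1-\alpha)\,h_-(\theta)$, where $h_\pm:=\operatorname{Hess}\Psi_\pm$ are the $n\times n$ Hessian matrices with respect to the coordinates $\theta^1,\dots,\theta^n$. *)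

theory Defs
  imports "HOL-Analysis.Analysis"
begin

definition partial_deriv :: "'n \<Rightarrow> (real^'n \<Rightarrow> real) \<Rightarrow> real^'n \<Rightarrow> real" where
  "partial_deriv i f x = deriv (\<lambda>t. f (x + t *\<^sub>R axis i 1)) 0"

text \<open>As with \<^const>\<open>deriv\<close>, the entries are meaningful only where the iterated partial
  derivatives exist. Entry \<open>(i, j)\<close> differentiates first in direction \<open>j\<close>, then in direction \<open>i\<close>.\<close>

definition Hess :: "(real^'n \<Rightarrow> real) \<Rightarrow> real^'n \<Rightarrow> real^'n^'n" where
  "Hess f x = (\<chi> i j. partial_deriv i (partial_deriv j f) x)"

definition symmetric_matrix :: "real^'n^'n \<Rightarrow> bool" where
  "symmetric_matrix A \<longleftrightarrow> transpose A = A"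

definition positive_definite :: "real^'n^'n \<Rightarrow> bool" where
  "positive_definite A \<longleftrightarrow> symmetric_matrix A \<and> (\<forall>v. v \<noteq> 0 \<longrightarrow> v \<bullet> (A *v v) > 0)"

definition \<Omega> :: "(real^'n) set" where
  "\<Omega> = {\<theta>. (\<Sum>i\<in>UNIV. exp (\<theta> $ i)) < 1}"

text \<open>The potentials are total functions on \<open>\<real>\<^sup>n\<close>; since \<^const>\<open>\<Omega>\<close> is open, the Hessians at
  points of \<^const>\<open>\<Omega>\<close> do not depend on the values outside it.\<close>

definition \<Psi>_plus :: "real^'n \<Rightarrow> real" where
  "\<Psi>_plus \<theta> = ln (1 + (\<Sum>i\<in>UNIV. exp (\<theta> $ i)))"

definition \<Psi>_minus :: "real^'n \<Rightarrow> real" where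
  "\<Psi>_minus \<theta> = - ln (1 - (\<Sum>i\<in>UNIV. exp (\<theta> $ i)))"

definition \<Psi> :: "real \<Rightarrow> real^'n \<Rightarrow> real" where
  "\<Psi> \<alpha> \<theta> = \<alpha> * \<Psi>_plus \<theta> + (1 - \<alpha>) * \<Psi>_minus \<theta>"

definition g :: "real \<Rightarrow> real^'n \<Rightarrow> real^'n^'n" where
  "g \<alpha> \<theta> = Hess (\<Psi> \<alpha>) \<theta>"

end

theory Submission
  imports Defs
begin

text \<open>With \<open>S = \<Sum>i. u\<^sub>i\<close>, \<open>Q = \<Sum>i. u\<^sub>i v\<^sub>i\<^sup>2\<close> and \<open>P = (\<Sum>i. u\<^sub>i v\<^sub>i)\<^sup>2\<close>, the quadratic form of
  \<open>g\<^sub>\<alpha>\<close> at \<open>v\<close> is the convex combination, with weights \<open>\<alpha>\<close> and \<open>1 - \<alpha>\<close>, of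
  \<open>Q / (1 + S) - P / (1 + S)\<^sup>2\<close> and \<open>Q / (1 - S) + P / (1 - S)\<^sup>2\<close>. The second is clearly positive; the
  first is so because \<open>P \<le> S Q\<close> by Cauchy--Schwarz.\<close>

definition exp_sum :: "real^'n \<Rightarrow> real" where
  "exp_sum x = (\<Sum>i\<in>UNIV. exp (x $ i))"

lemma exp_sum_pos: "exp_sum x > 0"
  unfolding exp_sum_def by (rule sum_pos) auto

lemma in_\<Omega>_iff: "x \<in> \<Omega> \<longleftrightarrow> exp_sum x < 1"
  by (simp add: \<Omega>_def exp_sum_def)

lemma DERIV_exp_sum_line:
  "((\<lambda>t. exp_sum (x + t *\<^sub>R axis j 1)) has_real_derivative exp (x $ j)) (at 0)"
proof -
  have "((\<lambda>t. exp_sum (x + t *\<^sub>R axis j 1)) has_real_derivative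
      (\<Sum>k\<in>UNIV. exp (x $ k) * axis j 1 $ k)) (at 0)"
    unfolding exp_sum_def by (auto intro!: derivative_eq_intros)
  moreover have "(\<Sum>k\<in>UNIV. exp (x $ k) * axis j 1 $ k) = exp (x $ j)"
    by (simp add: axis_def if_distrib cong: if_cong)
  ultimately show ?thesis by simp
qed

lemma open_\<Omega>: "open \<Omega>"
  unfolding \<Omega>_def by (intro open_Collect_less continuous_intros)

text \<open>Since \<open>\<Omega>\<close> is open, closed forms proved only on
  \<open>\<Omega>\<close> remain valid along a short segment through \<open>x\<close>, so they can
  be differentiated again there.\<close>

lemma eventually_line_in_\<Omega>:
  assumes "x \<in> \<Omega>"
  shows "\<forall>\<^sub>F t in nhds 0. x + t *\<^sub>R v \<in> \<Omega>"
proof -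
  have "((\<lambda>t. x + t *\<^sub>R v) \<longlongrightarrow> x + 0 *\<^sub>R v) (nhds 0)"
    by (intro tendsto_intros filterlim_ident)
  then show ?thesis
    using assms open_\<Omega> by (auto dest: topological_tendstoD)
qed

text \<open>The potential depends on the point only through \<open>exp_sum\<close>, so the chain
  rule applies; the factor \<open>exp (x $ j)\<close> is the partial derivative of
  \<open>exp_sum\<close>.\<close>

lemma partial_deriv_\<Psi>:
  fixes x :: "real^'n"
  assumes "x \<in> \<Omega>"
  shows "partial_deriv j (\<Psi> \<alpha>) x =
    (\<alpha> / (1 + exp_sum x) + (1 - \<alpha>) / (1 - exp_sum x)) * exp (x $ j)"
proof -
  have "\<Psi> \<alpha> y = \<alpha> * ln (1 + exp_sum y) + (1 - \<alpha>) * - ln (1 - exp_sum y)"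
    for y :: "real^'n"
    by (simp add: \<Psi>_def \<Psi>_plus_def \<Psi>_minus_def exp_sum_def)
  moreover have "((\<lambda>t. \<alpha> * ln (1 + exp_sum (x + t *\<^sub>R axis j 1))
        + (1 - \<alpha>) * - ln (1 - exp_sum (x + t *\<^sub>R axis j 1))) has_real_derivative
      (\<alpha> / (1 + exp_sum x) + (1 - \<alpha>) / (1 - exp_sum x)) * exp (x $ j)) (at 0)"
    using assms exp_sum_pos[of x]
    by (auto intro!: derivative_eq_intros DERIV_exp_sum_line
        simp: in_\<Omega>_iff divide_inverse algebra_simps)
  ultimately show ?thesis
    unfolding partial_deriv_def by (intro DERIV_imp_deriv) (simp only:)
qed

text \<open>The product rule splits the Hessian: differentiating \<open>exp (x $ j)\<close> gives
  the diagonal part, differentiating the scalar factor gives the rank-one part.\<close>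

lemma g_entry:
  assumes "x \<in> \<Omega>"
  shows "g \<alpha> x $ i $ j =
    (\<alpha> / (1 + exp_sum x) + (1 - \<alpha>) / (1 - exp_sum x)) * (if i = j then exp (x $ i) else 0)
    + ((1 - \<alpha>) / (1 - exp_sum x)\<^sup>2 - \<alpha> / (1 + exp_sum x)\<^sup>2) * (exp (x $ i) * exp (x $ j))"
    (is "_ = ?rhs")
proof -
  have nz: "1 + exp_sum x \<noteq> 0" "1 - exp_sum x \<noteq> 0"
    using assms exp_sum_pos[of x] by (auto simp: in_\<Omega>_iff)
  have "((\<lambda>t. \<alpha> / (1 + exp_sum (x + t *\<^sub>R axis i 1))
        + (1 - \<alpha>) / (1 - exp_sum (x + t *\<^sub>R axis i 1))) has_real_derivative
      ((1 - \<alpha>) / (1 - exp_sum x)\<^sup>2 - \<alpha> / (1 + exp_sum x)\<^sup>2) * exp (x $ i)) (at 0)"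
    using nz by (auto intro!: derivative_eq_intros DERIV_exp_sum_line
        simp: power2_eq_square divide_inverse) (simp add: algebra_simps)
  moreover have "((\<lambda>t. exp ((x + t *\<^sub>R axis i 1) $ j)) has_real_derivative
      (if i = j then exp (x $ i) else 0)) (at 0)"
    by (auto intro!: derivative_eq_intros simp: axis_def)
  ultimately have "((\<lambda>t. (\<alpha> / (1 + exp_sum (x + t *\<^sub>R axis i 1))
        + (1 - \<alpha>) / (1 - exp_sum (x + t *\<^sub>R axis i 1))) * exp ((x + t *\<^sub>R axis i 1) $ j))
      has_real_derivative ?rhs) (at 0)"
    by (rule DERIV_cong[OF DERIV_mult]) (simp add: algebra_simps)
  \<comment> \<open>Agreement near \<open>t = 0\<close> is enough, because \<open>deriv\<close> at 0
    sees only the germ of the function.\<close>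
  moreover have "\<forall>\<^sub>F t in nhds 0. partial_deriv j (\<Psi> \<alpha>) (x + t *\<^sub>R axis i 1) =
      (\<alpha> / (1 + exp_sum (x + t *\<^sub>R axis i 1))
        + (1 - \<alpha>) / (1 - exp_sum (x + t *\<^sub>R axis i 1))) * exp ((x + t *\<^sub>R axis i 1) $ j)"
    using eventually_line_in_\<Omega>[OF assms] by eventually_elim (rule partial_deriv_\<Psi>)
  ultimately show ?thesis
    by (simp only: g_def Hess_def vec_lambda_beta partial_deriv_def[of i] deriv_cong_ev[OF _ refl]
        DERIV_imp_deriv)
qed

lemma quadratic_form_diagonal_plus_rank_one:
  fixes A :: "real^'n^'n"
  assumes "\<And>i j. A $ i $ j = a * (if i = j then w i else 0) + b * (w i * w j)"
  shows "v \<bullet> (A *v v) = a * (\<Sum>i\<in>UNIV. w i * (v $ i)\<^sup>2) + b * (\<Sum>i\<in>UNIV. w i * v $ i)\<^sup>2"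
proof -
  have row: "(A *v v) $ i = a * (w i * v $ i) + b * w i * (\<Sum>j\<in>UNIV. w j * v $ j)" for i
  proof -
    have "(A *v v) $ i
      = (\<Sum>j\<in>UNIV. (if i = j then a * w i * v $ j else 0) + b * w i * (w j * v $ j))"
      unfolding matrix_vector_mult_def by (auto simp: assms algebra_simps intro!: sum.cong)
    then show ?thesis
      by (simp add: sum.distrib sum_distrib_left)
  qed
  have "v \<bullet> (A *v v) = (\<Sum>i\<in>UNIV. a * (w i * (v $ i)\<^sup>2)
      + b * (\<Sum>j\<in>UNIV. w j * v $ j) * (w i * v $ i))"
    by (simp add: inner_vec_def row power2_eq_square algebra_simps)
  then show ?thesis
    by (simp add: sum.distrib flip: sum_distrib_left) (simp add: power2_eq_square)
qed

text \<open>Splitting each weight as \<open>sqrt (w i) * sqrt (w i)\<close> reduces this to the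
  unweighted inequality for \<open>sqrt (w i)\<close> and \<open>sqrt (w i) * v i\<close>.\<close>

lemma weighted_Cauchy_Schwarz_sum:
  fixes w v :: "'a \<Rightarrow> real"
  assumes "\<And>i. i \<in> I \<Longrightarrow> w i \<ge> 0"
  shows "(\<Sum>i\<in>I. w i * v i)\<^sup>2 \<le> (\<Sum>i\<in>I. w i) * (\<Sum>i\<in>I. w i * (v i)\<^sup>2)"
proof -
  have "(\<Sum>i\<in>I. sqrt (w i) * (sqrt (w i) * v i))\<^sup>2
      \<le> (\<Sum>i\<in>I. (sqrt (w i))\<^sup>2) * (\<Sum>i\<in>I. (sqrt (w i) * v i)\<^sup>2)"
    by (rule Cauchy_Schwarz_ineq_sum)
  moreover have "(\<Sum>i\<in>I. sqrt (w i) * (sqrt (w i) * v i)) = (\<Sum>i\<in>I. w i * v i)"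
    using assms by (auto intro!: sum.cong simp flip: mult.assoc)
  ultimately show ?thesis
    using assms by (simp add: power_mult_distrib)
qed

lemma convex_comb_positive:
  fixes S P Q \<alpha> :: real
  assumes "0 \<le> \<alpha>" "\<alpha> \<le> 1" "0 < S" "S < 1" "0 \<le> P" "P \<le> S * Q" "0 < Q"
  shows "0 < (\<alpha> / (1 + S) + (1 - \<alpha>) / (1 - S)) * Q + ((1 - \<alpha>) / (1 - S)\<^sup>2 - \<alpha> / (1 + S)\<^sup>2) * P"
proof -
  define X where "X = Q / (1 + S) - P / (1 + S)\<^sup>2"
  define Y where "Y = Q / (1 - S) + P / (1 - S)\<^sup>2"
  have "Q / (1 + S) = Q * (1 + S) / (1 + S)\<^sup>2"
    using assms by (simp add: power2_eq_square)
  \<comment> \<open>Over the common denominator the numerator is a positive term plus the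
    nonnegative Cauchy-Schwarz defect.\<close>
  then have "X = (Q + (S * Q - P)) / (1 + S)\<^sup>2"
    by (simp add: X_def algebra_simps flip: diff_divide_distrib)
  then have "0 < X"
    using assms by simp
  moreover have "0 < Y"
    using assms by (simp add: Y_def add_pos_nonneg)
  ultimately have "0 < \<alpha> * X + (1 - \<alpha>) * Y"
    \<comment> \<open>For \<open>\<alpha> = 0\<close> only \<open>Y\<close> remains; otherwise
      \<open>\<alpha> * X\<close> is already positive and the other term is nonnegative.\<close>
    using assms by (cases "\<alpha> = 0") (auto intro!: add_pos_nonneg)
  then show ?thesis
    by (simp add: X_def Y_def algebra_simps)
qed

theorem theorem2p1:
  fixes \<alpha> :: real and \<theta> :: "real^'n"
  assumes "\<alpha> \<in> {0..1}" and "\<theta> \<in> \<Omega>"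
  shows "positive_definite (g \<alpha> \<theta>)"
  unfolding positive_definite_def
proof (intro conjI allI impI)
  show "symmetric_matrix (g \<alpha> \<theta>)"
    \<comment> \<open>Symmetry is read off the closed form, with no appeal to the equality of mixed
      partials.\<close>
    by (auto simp: symmetric_matrix_def transpose_def vec_eq_iff g_entry[OF assms(2)])
next
  fix v :: "real^'n"
  assume "v \<noteq> 0"
  then obtain k where k: "v $ k \<noteq> 0"
    by (auto simp: vec_eq_iff)
  have "0 < (\<Sum>i\<in>UNIV. exp (\<theta> $ i) * (v $ i)\<^sup>2)"
    by (rule sum_pos2[where i = k]) (use k in auto)
  moreover have "(\<Sum>i\<in>UNIV. exp (\<theta> $ i) * v $ i)\<^sup>2
      \<le> exp_sum \<theta> * (\<Sum>i\<in>UNIV. exp (\<theta> $ i) * (v $ i)\<^sup>2)"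
    unfolding exp_sum_def by (rule weighted_Cauchy_Schwarz_sum) simp
  ultimately show "0 < v \<bullet> (g \<alpha> \<theta> *v v)"
    \<comment> \<open>Here \<open>w i\<close> is \<open>exp (\<theta> $ i)\<close>, which leaves the
      scalar inequality with \<open>S = exp_sum \<theta>\<close>.\<close>
    unfolding quadratic_form_diagonal_plus_rank_one[OF g_entry[OF assms(2)]]
    using assms exp_sum_pos[of \<theta>] by (intro convex_comb_positive) (auto simp: in_\<Omega>_iff)
qed

end
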